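(* Let $S=\{x_1,\dots,x_n\}\subset\mathbb{R}^2$ be a set of $n\ge 2$ distinct points in general position, all of which are vertices of the convex hull $CH(S)$, and let $DV(S)$ be its division tree. For every weight point $p\in\mathbb{R}^2$ which is not a vertex of $CH(S)$, the problem $$M(W_4):\quad \max_{E(x_i,x_j)\subset FVB(S)}\ \max_{x\in E(x_i,x_j)}\frac{\|x-p\|}{\max_k\|x-x_k\|}$$ has a unique optimal solution $x^*$. Moreover, the plane (with the vertices of $CH(S)$ removed) can be divided into several pairwise non-overlapping regions such that, for each region, either there is one node $O$ of $DV(S)$ with $x^*=O$ for all $p$ in the region, or there is one edge $E$ of $DV(S)$ with $x^*\in E^\circ$ for all $p$ in the region.
   Context: $\|\cdot\|$ is the Euclidean norm. $S$ is in general position if no four of its points are co-circular. $FV(x_i)=\{y\in\mathbb{R}^2:\|y-x_i\|>\|y-x_j\|\ \forall j\neq i\}$ is the farthest-point Voronoi cell of $x_i$. $FVB(S)$ is the boundary of the farthest-point Voronoi diagram, i.e. the set of points whose maximal distance to $S$ is attained by at least two points of $S$. The common boundary of two cells $FV(x_i)$ and $FV(x_j)$ is an edge $E(x_i,x_j)$ (lying on the perpendicular bisector of $x_ix_j$). Intersections of edges are nodes. $\infty$ is a special single node, which is the endpoint of every unbounded edge. $E^\circ$ denotes the edge $E$ with its two endpoints removed. The objective function $\|x-p\|/\max_k\|x-x_k\|$ takes at $x=\infty$ its limiting value $1$. $\varepsilon(S)$ is the center of the minimum enclosing circle of $S$, i.e. the minimizer of $\max_i\|x-x_i\|$. It lies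 on $FVB(S)$. The division tree $DV(S)$ is $FVB(S)$ regarded as a tree rooted at $\varepsilon(S)$, whose leaves are at $\infty$. If $\varepsilon(S)$ is a node it is the root. If $\varepsilon(S)$ lies in the interior of an edge, that edge is split at $\varepsilon(S)$ into two edges and $\varepsilon(S)$ becomes a new node, used as the root. *)

theory Defs
  imports "HOL-Analysis.Analysis" "HOL-Library.Disjoint_Sets"
begin

definition general_position :: "(real^2) set \<Rightarrow> bool" where
  "general_position S \<longleftrightarrow> (\<forall>T\<subseteq>S. card T = 4 \<longrightarrow> \<not> (\<exists>c r. T \<subseteq> sphere c r))"

definition far_dist :: "(real^2) set \<Rightarrow> real^2 \<Rightarrow> real" where
  "far_dist S y = Max (dist y ` S)"

definition FV :: "(real^2) set \<Rightarrow> real^2 \<Rightarrow> (real^2) set" where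
  "FV S a = {y. \<forall>b\<in>S - {a}. dist y a > dist y b}"

definition FVB :: "(real^2) set \<Rightarrow> (real^2) set" where
  "FVB S = {y. \<exists>a\<in>S. \<exists>b\<in>S. a \<noteq> b \<and> dist y a = far_dist S y \<and> dist y b = far_dist S y}"

definition edge :: "(real^2) set \<Rightarrow> real^2 \<Rightarrow> real^2 \<Rightarrow> (real^2) set" where
  "edge S a b = frontier (FV S a) \<inter> frontier (FV S b)"

text \<open>
  Edges are stored as subsets of the plane. The plane together with the point at infinity is the
  type \<open>(real^2) option\<close>, where \<open>None\<close> is infinity;
  \<open>with_infinity\<close> adds infinity to the unbounded edges.
\<close>

definition fv_edges :: "(real^2) set \<Rightarrow> (real^2) set set" where
  "fv_edges S = {edge S a b | a b. a \<in> S \<and> b \<in> S \<and> a \<noteq> b \<and> edge S a b \<noteq> {} \<and> edge S a b \<subseteq> FVB S}"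

definition with_infinity :: "(real^2) set \<Rightarrow> (real^2) option set" where
  "with_infinity E = Some ` E \<union> (if bounded E then {} else {None})"

text \<open>
  Infinity is a node by convention: for two points there is a single edge, a full line, and hence
  no intersection of distinct edges.
\<close>

definition fv_nodes :: "(real^2) set \<Rightarrow> (real^2) option set" where
  "fv_nodes S =
     insert None {v. \<exists>E\<in>fv_edges S. \<exists>F\<in>fv_edges S. E \<noteq> F \<and> v \<in> with_infinity E \<inter> with_infinity F}"

definition mec_center :: "(real^2) set \<Rightarrow> real^2" where
  "mec_center S = (ARG_MIN (far_dist S) y. True)"

text \<open>
  An edge is a closed segment, ray or line, so removing an interior point \<open>c\<close> leaves two
  connected components; adding \<open>c\<close> back to each of them gives the two halves of the edge.
\<close>

definition split_edge :: "real^2 \<Rightarrow> (real^2) set \<Rightarrow> (real^2) set set" where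
  "split_edge c E = (if c \<in> E then insert c ` components (E - {c}) else {E})"

text \<open>Nodes and edges of the division tree, whose root is \<^term>\<open>Some (mec_center S)\<close>.\<close>

definition dv_nodes :: "(real^2) set \<Rightarrow> (real^2) option set" where
  "dv_nodes S = insert (Some (mec_center S)) (fv_nodes S)"

definition dv_edges :: "(real^2) set \<Rightarrow> (real^2) set set" where
  "dv_edges S =
     (if Some (mec_center S) \<in> fv_nodes S then fv_edges S
      else (\<Union>E\<in>fv_edges S. split_edge (mec_center S) E))"

definition endpoints :: "(real^2) set \<Rightarrow> (real^2) option set" where
  "endpoints E = Some ` {v. v extreme_point_of E} \<union> (if bounded E then {} else {None})"

definition open_edge :: "(real^2) set \<Rightarrow> (real^2) option set" where
  "open_edge E = with_infinity E - endpoints E"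

fun objective :: "(real^2) set \<Rightarrow> real^2 \<Rightarrow> (real^2) option \<Rightarrow> real" where
  "objective S p (Some x) = dist x p / far_dist S x"
| "objective S p None = 1"

definition optimal :: "(real^2) set \<Rightarrow> real^2 \<Rightarrow> (real^2) option \<Rightarrow> bool" where
  "optimal S p = is_arg_max (objective S p) (\<lambda>x. \<exists>E\<in>fv_edges S. x \<in> with_infinity E)"

end

theory Submission
  imports Defs
begin

text \<open>
  Let \<open>R(x)\<close> be the largest distance from \<open>x\<close> to \<open>S\<close> and \<open>I(x)\<close> the set of farthest points of \<open>x\<close>.
  If \<open>p\<close> lies in the hull but not in \<open>S\<close>, the objective is less than 1 at every finite point, so infinity
  is the only optimal solution. Otherwise its supremum over the whole plane exceeds 1 and is attained
  at some \<open>x\<close>; first-order optimality says that \<open>p\<close> is the image of some \<open>z\<close> in the hull of \<open>I(x)\<close>,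
  \<open>z\<close> neither \<open>x\<close> nor in \<open>I(x)\<close>, under inversion in the circle of centre \<open>x\<close> and radius \<open>R(x)\<close>.
  This forces \<open>I(x)\<close> to have at least two elements, so \<open>x\<close> lies on the Voronoi boundary. Conversely
  every such inversion has \<open>x\<close> as its strict global maximizer, hence \<open>x\<close> is unique.

  The pair \<open>(x, z)\<close> is thus determined by \<open>p\<close>. Fixing \<open>I(x)\<close> and the position of \<open>x\<close> relative to the
  root and of \<open>z\<close> relative to \<open>x\<close> leaves a convex set of pairs, whose image under inversion is a
  connected region of points \<open>p\<close>; there are finitely many of these.
\<close>

section \<open>Distances, half-spaces and convex hulls\<close>

lemma dist_sq: "(dist x (y::'a::real_inner))\<^sup>2 = x \<bullet> x - 2 * (x \<bullet> y) + y \<bullet> y"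
  by (simp add: dist_norm power2_norm_eq_inner inner_diff inner_commute)

lemma dist_less_iff_inner:
  "dist x (a::'a::real_inner) < dist x b \<longleftrightarrow> 2 * ((b - a) \<bullet> x) < b \<bullet> b - a \<bullet> a"
proof -
  have "dist x a < dist x b \<longleftrightarrow> (dist x a)\<^sup>2 < (dist x b)\<^sup>2"
    using power_mono_iff[of "dist x b" "dist x a" 2] by (auto simp: not_le[symmetric])
  then show ?thesis
    by (auto simp: dist_sq inner_diff inner_commute)
qed

lemma dist_eq_iff_inner:
  "dist x (a::'a::real_inner) = dist x b \<longleftrightarrow> 2 * ((b - a) \<bullet> x) = b \<bullet> b - a \<bullet> a"
  using dist_less_iff_inner[of x a b] dist_less_iff_inner[of x b a]
  by (auto simp: inner_diff_left)

lemma convex_equidistant: "convex {x. dist x (a::'a::real_inner) = dist x b}"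
proof -
  have "{x. dist x a = dist x b} = {x. (2 *\<^sub>R (b - a)) \<bullet> x = b \<bullet> b - a \<bullet> a}"
    by (simp add: dist_eq_iff_inner)
  then show ?thesis by (metis convex_hyperplane)
qed

lemma convex_closer: "convex {x. dist x (a::'a::real_inner) < dist x b}"
proof -
  have "{x. dist x a < dist x b} = {x. (2 *\<^sub>R (b - a)) \<bullet> x < b \<bullet> b - a \<bullet> a}"
    by (simp add: dist_less_iff_inner)
  then show ?thesis by (metis convex_halfspace_lt)
qed

text \<open>If \<open>z\<close> had distance at least \<open>r\<close> from \<open>x\<close>, every
  point of \<open>K\<close> would lie strictly on the near side of the hyperplane through
  \<open>z\<close> perpendicular to \<open>z - x\<close>. So would the whole hull, although
  \<open>z\<close> is on that hyperplane.\<close>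

lemma convex_hull_dist_less:
  fixes x z :: "'a::real_inner"
  assumes "\<And>q. q \<in> K \<Longrightarrow> dist x q \<le> r" and "z \<in> convex hull K" and "z \<notin> K"
  shows "dist x z < r"
proof (rule ccontr)
  assume "\<not> dist x z < r"
  define H where "H = {q. (z - x) \<bullet> q < (z - x) \<bullet> z}"
  have "q \<in> H" if "q \<in> K" for q
  proof -
    have "dist x q \<le> dist x z"
      using assms(1)[OF that] \<open>\<not> dist x z < r\<close> by simp
    then have 1: "(dist x q)\<^sup>2 \<le> (dist x z)\<^sup>2"
      by (simp add: power_mono)
    have "0 < (z - q) \<bullet> (z - q)"
      using that assms(3) by auto
    then show ?thesis
      using 1 by (simp add: H_def dist_sq inner_diff inner_commute)
  qed
  moreover have "convex H"
    unfolding H_def by (rule convex_halfspace_lt)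
  ultimately have "convex hull K \<subseteq> H"
    by (intro hull_minimal subsetI)
  then show False
    using assms(2) by (auto simp: H_def)
qed

text \<open>Separate \<open>p\<close> from the hull by a direction \<open>u\<close>. Along the ray
  of points \<open>t *\<^sub>R u\<close>, the squared distance to \<open>p\<close> minus that to
  \<open>q\<close> is affine in \<open>t\<close> with slope
  \<open>2 * (u \<bullet> (q - p)) > 0\<close>, hence eventually positive. This serves both to find
  unbounded cells and to find ratios above 1.\<close>

lemma far_point_exists:
  fixes p :: "'a::euclidean_space"
  assumes "finite K" "K \<noteq> {}" "p \<notin> convex hull K"
  shows "\<exists>y. B < norm y \<and> (\<forall>q\<in>K. dist y q < dist y p)"
proof -
  have "closed (convex hull K)"
    using assms(1) by (simp add: compact_imp_closed finite_imp_compact_convex_hull)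
  then obtain u b where u: "u \<bullet> p < b" "\<And>q. q \<in> convex hull K \<Longrightarrow> b < u \<bullet> q"
    using separating_hyperplane_closed_point[of "convex hull K" p] assms(3) by auto
  have pos: "0 < u \<bullet> (q - p)" if "q \<in> K" for q
    using u(1) u(2)[of q] that hull_inc[of q K convex] by (simp add: inner_diff_right)
  obtain q0 where "q0 \<in> K"
    using assms(2) by auto
  then have "u \<noteq> 0"
    using pos by force
  have "\<forall>\<^sub>F t in at_top. dist (t *\<^sub>R u) q < dist (t *\<^sub>R u) p" if "q \<in> K" for q
    using eventually_gt_at_top[of "(q \<bullet> q - p \<bullet> p) / (2 * (u \<bullet> (q - p)))"]
  proof eventually_elim
    case (elim t)
    then have "q \<bullet> q - p \<bullet> p < t * (2 * (u \<bullet> (q - p)))"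
      using pos[OF that] by (simp add: pos_divide_less_eq)
    then show ?case
      by (simp add: dist_less_iff_inner inner_diff inner_commute algebra_simps)
  qed
  then have "\<forall>\<^sub>F t in at_top. \<forall>q\<in>K. dist (t *\<^sub>R u) q < dist (t *\<^sub>R u) p"
    using assms(1) by (simp add: eventually_ball_finite)
  moreover have "\<forall>\<^sub>F t in at_top. B < norm (t *\<^sub>R u)"
    using eventually_gt_at_top[of "\<bar>B\<bar> / norm u"]
  proof eventually_elim
    case (elim t)
    then have "\<bar>B\<bar> < t * norm u"
      using \<open>u \<noteq> 0\<close> by (simp add: divide_simps)
    also have "\<dots> \<le> norm (t *\<^sub>R u)"
      by (simp add: mult_right_mono)
    finally show ?case by simp
  qed
  ultimately have "\<forall>\<^sub>F t in at_top. B < norm (t *\<^sub>R u) \<and> (\<forall>q\<in>K. dist (t *\<^sub>R u) q < dist (t *\<^sub>R u) p)"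
    by (rule eventually_conj[rotated])
  then show ?thesis
    using eventually_happens trivial_limit_at_top_linorder by blast
qed

lemma notin_convex_hull_minus_extreme:
  assumes "a extreme_point_of (convex hull S)"
  shows "a \<notin> convex hull (S - {a})"
proof -
  have "convex (convex hull S - {a})"
    using assms by (simp add: extreme_point_of_stillconvex)
  moreover have "S - {a} \<subseteq> convex hull S - {a}"
    by (auto intro: hull_inc)
  ultimately have "convex hull (S - {a}) \<subseteq> convex hull S - {a}"
    by (intro hull_minimal)
  then show ?thesis by auto
qed

text \<open>An extreme point of \<open>D\<close> lies in no open segment with endpoints in
  \<open>D\<close>, so deleting it breaks no segment of \<open>C\<close>.\<close>

lemma convex_diff_extreme_points:
  assumes "convex C" "C \<subseteq> D" "\<And>v. v \<in> X \<Longrightarrow> v extreme_point_of D"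
  shows "convex (C - X)"
  unfolding convex_contains_open_segment
proof (intro ballI subsetI)
  fix a b w assume "a \<in> C - X" "b \<in> C - X" "w \<in> open_segment a b"
  moreover have "w \<in> C"
    using calculation assms(1) by (auto simp: convex_contains_open_segment)
  ultimately show "w \<in> C - X"
    using assms(2,3) by (auto simp: extreme_point_of_def)
qed

subsection \<open>The farthest distance\<close>

text \<open>This is the set I(x) of the overview. One element means an open cell, two a point on a
  single bisector, three a Voronoi vertex.\<close>

definition far_set :: "(real^2) set \<Rightarrow> real^2 \<Rightarrow> (real^2) set" where
  "far_set S x = {q\<in>S. dist x q = far_dist S x}"

lemma far_dist_ge: "finite S \<Longrightarrow> q \<in> S \<Longrightarrow> dist x q \<le> far_dist S x"
  by (simp add: far_dist_def)

lemma far_set_nonempty: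
  assumes "finite S" "S \<noteq> {}"
  shows "far_set S x \<noteq> {}"
proof -
  have "far_dist S x \<in> dist x ` S"
    unfolding far_dist_def using assms by (intro Max_in) auto
  then show ?thesis by (auto simp: far_set_def)
qed

lemma far_dist_less_iff:
  "finite S \<Longrightarrow> S \<noteq> {} \<Longrightarrow> far_dist S x < r \<longleftrightarrow> (\<forall>q\<in>S. dist x q < r)"
  by (simp add: far_dist_def)

text \<open>Comparing with one fixed member \<open>a\<close> eliminates the maximum. The remaining
  conditions compare two distances each, so they are linear in \<open>x\<close>: equalities within
  \<open>I\<close>, strict inequalities outside.\<close>

lemma far_set_eq_iff:
  assumes "finite S" "I \<subseteq> S" "a \<in> I"
  shows "far_set S x = I \<longleftrightarrow> (\<forall>q\<in>I. dist x q = dist x a) \<and> (\<forall>q\<in>S - I. dist x q < dist x a)"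
proof
  assume "far_set S x = I"
  moreover have "dist x q \<le> far_dist S x" if "q \<in> S" for q
    using that assms(1) by (rule far_dist_ge[rotated])
  ultimately show "(\<forall>q\<in>I. dist x q = dist x a) \<and> (\<forall>q\<in>S - I. dist x q < dist x a)"
    using assms(3) by (force simp: far_set_def)
next
  assume *: "(\<forall>q\<in>I. dist x q = dist x a) \<and> (\<forall>q\<in>S - I. dist x q < dist x a)"
  have "a \<in> S" using assms by auto
  have "far_dist S x = dist x a"
    unfolding far_dist_def
  proof (rule Max_eqI)
    show "r \<le> dist x a" if "r \<in> dist x ` S" for r
      using that * by (cases "\<exists>q\<in>I. r = dist x q") (auto intro: less_imp_le)
  qed (use assms \<open>a \<in> S\<close> in auto)
  moreover have "q \<in> I" if "q \<in> S" "dist x q = dist x a" for q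
    using *[THEN conjunct2, THEN bspec, of q] that by auto
  ultimately show "far_set S x = I"
    using * assms(2) by (auto simp: far_set_def)
qed

lemma convex_far_set_eq:
  assumes "finite S" "I \<subseteq> S" "I \<noteq> {}"
  shows "convex {x. far_set S x = I}"
proof -
  obtain a where "a \<in> I" using assms by auto
  then have "{x. far_set S x = I} =
      (\<Inter>q\<in>I. {x. dist x q = dist x a}) \<inter> (\<Inter>q\<in>S - I. {x. dist x q < dist x a})"
    using far_set_eq_iff[OF assms(1,2) \<open>a \<in> I\<close>] by auto
  also have "convex \<dots>"
    by (intro convex_Int convex_INT convex_equidistant convex_closer)
  finally show ?thesis .
qed

lemma far_dist_triangle:
  assumes "finite S" "S \<noteq> {}"
  shows "far_dist S x \<le> dist x y + far_dist S y"
proof -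
  obtain q where "q \<in> S" "dist x q = far_dist S x"
    using far_set_nonempty[OF assms] by (auto simp: far_set_def)
  then show ?thesis
    using far_dist_ge[OF assms(1), of q y] dist_triangle[of x q y] by simp
qed

lemma continuous_on_far_dist:
  assumes "finite S" "S \<noteq> {}"
  shows "continuous_on X (far_dist S)"
proof -
  have "1-lipschitz_on X (far_dist S)"
  proof (rule lipschitz_onI)
    show "dist (far_dist S x) (far_dist S y) \<le> 1 * dist x y" for x y
      using far_dist_triangle[OF assms, of x y] far_dist_triangle[OF assms, of y x]
      by (simp add: dist_real_def abs_le_iff dist_commute)
  qed simp
  then show ?thesis by (rule lipschitz_on_continuous_on)
qed

lemma far_dist_pos:
  assumes "finite S" "card S \<ge> 2"
  shows "0 < far_dist S x"
proof -
  obtain a b where "a \<in> S" "b \<in> S" "a \<noteq> b"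
    using assms card_le_Suc0_iff_eq[of S] by auto
  then have "0 < dist x a \<or> 0 < dist x b"
    by auto
  then show ?thesis
    using far_dist_ge[OF assms(1)] \<open>a \<in> S\<close> \<open>b \<in> S\<close> by (meson less_le_trans)
qed

lemma FVB_iff: "x \<in> FVB S \<longleftrightarrow> (\<exists>a\<in>far_set S x. \<exists>b\<in>far_set S x. a \<noteq> b)"
  by (auto simp: FVB_def far_set_def)

subsection \<open>The optimal solution as the centre of an inversion\<close>

text \<open>As a function of \<open>q\<close>, the difference of the squared distances from
  \<open>y\<close> and from \<open>x\<close> is affine. It is at most
  \<open>(far_dist S y)\<^sup>2 - (far_dist S x)\<^sup>2\<close> at every farthest point of
  \<open>x\<close>, hence on their hull; \<open>H\<close> is the corresponding half-space.\<close>

lemma far_dist_lower_bound: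
  assumes "finite S" "z \<in> convex hull far_set S x"
  shows "(dist y z)\<^sup>2 + (far_dist S x)\<^sup>2 - (dist x z)\<^sup>2 \<le> (far_dist S y)\<^sup>2"
proof -
  define h where "h = (far_dist S y)\<^sup>2 - (far_dist S x)\<^sup>2 - y \<bullet> y + x \<bullet> x"
  define H where "H = {q. (2 *\<^sub>R (x - y)) \<bullet> q \<le> h}"
  have "q \<in> H" if "q \<in> far_set S x" for q
  proof -
    have "(dist y q)\<^sup>2 \<le> (far_dist S y)\<^sup>2"
      using that assms(1) by (auto simp: far_set_def intro!: power_mono far_dist_ge)
    moreover have "(dist x q)\<^sup>2 = (far_dist S x)\<^sup>2"
      using that by (simp add: far_set_def)
    ultimately show ?thesis
      by (simp add: H_def h_def dist_sq inner_diff_left)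
  qed
  moreover have "convex H"
    unfolding H_def by (rule convex_halfspace_le)
  ultimately have "convex hull far_set S x \<subseteq> H"
    by (intro hull_minimal subsetI)
  then have "z \<in> H"
    using assms(2) by auto
  then show ?thesis
    by (simp add: H_def h_def dist_sq inner_diff_left)
qed

text \<open>The circle of inversion is the smallest one about \<open>x\<close> that encloses
  \<open>S\<close>. For \<open>z = x\<close>, division by zero yields the value \<open>x\<close>;
  that case is always excluded below.\<close>

definition far_inversion :: "(real^2) set \<Rightarrow> real^2 \<Rightarrow> real^2 \<Rightarrow> real^2" where
  "far_inversion S x z = x + ((far_dist S x)\<^sup>2 / (dist x z)\<^sup>2) *\<^sub>R (z - x)"

text \<open>With \<open>l\<close> the ratio at \<open>x\<close>, the squared distance from
  \<open>y\<close> to \<open>p\<close> equals \<open>l\<^sup>2 * ((dist y z)\<^sup>2 + R\<^sup>2 -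
  (dist x z)\<^sup>2)\<close> minus the term \<open>(l\<^sup>2 - 1) * (w \<bullet> w)\<close>, which
  is positive for \<open>y\<close> other than \<open>x\<close>. The bracket is bounded by
  \<open>far_dist_lower_bound\<close>.\<close>

lemma far_inversion_optimal:
  assumes "finite S" "card S \<ge> 2" and z: "z \<in> convex hull far_set S x - far_set S x" "z \<noteq> x"
    and p: "p = far_inversion S x z"
  shows "1 < dist x p / far_dist S x"
    and "y \<noteq> x \<Longrightarrow> dist y p / far_dist S y < dist x p / far_dist S x"
proof -
  define R where "R = far_dist S x"
  define e where "e = z - x"
  define l where "l = R / norm e"
  have "0 < R"
    unfolding R_def using assms(1,2) by (rule far_dist_pos)
  have "0 < norm e"
    using z(2) by (simp add: e_def)
  \<comment> \<open>A hull point that is not itself a farthest point is strictly inside the circle;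
    this is what makes \<open>l\<close> exceed 1.\<close>
  have "norm e < R"
    using convex_hull_dist_less[of "far_set S x" x R z] z(1)
    by (auto simp: e_def R_def far_set_def dist_norm norm_minus_commute)
  then have l: "1 < l"
    using \<open>0 < norm e\<close> by (simp add: l_def)
  have p': "p = x + l\<^sup>2 *\<^sub>R e"
    by (simp add: p far_inversion_def l_def R_def e_def dist_norm norm_minus_commute power_divide)
  have lR: "l * norm e = R"
    using \<open>0 < norm e\<close> by (simp add: l_def)
  then have lR2: "l\<^sup>2 * (e \<bullet> e) = R\<^sup>2"
    by (simp flip: power2_norm_eq_inner power_mult_distrib)
  have "dist x p = l * R"
    using lR by (simp add: p' dist_norm power2_eq_square)
  then have ratio: "dist x p / far_dist S x = l"
    using \<open>0 < R\<close> by (simp add: R_def)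
  then show "1 < dist x p / far_dist S x"
    using l by simp
  assume "y \<noteq> x"
  define w where "w = y - x"
  have y: "y = x + w" "z = x + e"
    by (simp_all add: w_def e_def)
  have "0 < (l\<^sup>2 - 1) * (w \<bullet> w)"
  proof (rule mult_pos_pos)
    show "0 < l\<^sup>2 - 1"
      using l by (simp add: one_less_power)
    show "0 < w \<bullet> w"
      using \<open>y \<noteq> x\<close> by (simp add: w_def)
  qed
  also have "\<dots> = l\<^sup>2 * ((dist y z)\<^sup>2 + R\<^sup>2 - (dist x z)\<^sup>2) - (dist y p)\<^sup>2"
  proof -
    have "(dist y z)\<^sup>2 - (dist x z)\<^sup>2 = w \<bullet> w - 2 * (w \<bullet> e)"
      by (simp add: y dist_norm power2_norm_eq_inner inner_diff inner_commute)
    then have yz: "(dist y z)\<^sup>2 + R\<^sup>2 - (dist x z)\<^sup>2 = w \<bullet> w - 2 * (w \<bullet> e) + R\<^sup>2"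
      by linarith
    have "y - p = w - l\<^sup>2 *\<^sub>R e"
      by (simp add: y p')
    then have "(dist y p)\<^sup>2 = w \<bullet> w - 2 * l\<^sup>2 * (w \<bullet> e) + l\<^sup>2 * (l\<^sup>2 * (e \<bullet> e))"
      by (simp add: dist_norm power2_norm_eq_inner inner_diff inner_commute)
    then show ?thesis
      unfolding yz lR2 by (simp add: algebra_simps)
  qed
  also have "\<dots> \<le> l\<^sup>2 * (far_dist S y)\<^sup>2 - (dist y p)\<^sup>2"
    using far_dist_lower_bound[OF assms(1), of z x y] z(1)
    by (simp add: R_def mult_left_mono)
  finally have "0 < l\<^sup>2 * (far_dist S y)\<^sup>2 - (dist y p)\<^sup>2" .
  then have "(dist y p)\<^sup>2 < (l * far_dist S y)\<^sup>2"
    by (simp only: power_mult_distrib diff_gt_0_iff_gt)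
  moreover have "0 \<le> l * far_dist S y"
    using l far_dist_pos[OF assms(1,2), of y] by simp
  ultimately have "dist y p < l * far_dist S y"
    by (rule power2_less_imp_less)
  then show "dist y p / far_dist S y < dist x p / far_dist S x"
    using far_dist_pos[OF assms(1,2), of y] by (simp add: ratio divide_simps)
qed

text \<open>Some point \<open>y0\<close> has ratio above 1. Far away the ratio is close to 1, so all
  points doing at least as well as \<open>y0\<close> lie in a compact ball, on which the continuous
  ratio attains its maximum.\<close>

lemma ratio_attains_max:
  assumes S: "finite S" "card S \<ge> 2" and p: "p \<notin> convex hull S"
  shows "\<exists>x. 1 < dist x p / far_dist S x \<and>
    (\<forall>y. dist y p / far_dist S y \<le> dist x p / far_dist S x)"
proof -
  define g where "g y = dist y p / far_dist S y" for y
  have "S \<noteq> {}" using S by auto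
  obtain y0 where "\<forall>q\<in>S. dist y0 q < dist y0 p"
    using far_point_exists[OF S(1) \<open>S \<noteq> {}\<close> p] by auto
  then have "far_dist S y0 < dist y0 p"
    using S \<open>S \<noteq> {}\<close> by (simp add: far_dist_less_iff)
  then have g0: "1 < g y0"
    using far_dist_pos[OF S] by (simp add: g_def)
  obtain s where "s \<in> S" using \<open>S \<noteq> {}\<close> by auto
  \<comment> \<open>Chosen so that the triangle inequality through \<open>s\<close>, in the form
    \<open>(g y0 - 1) * dist y p \<le> g y0 * dist p s\<close>, bounds \<open>dist y p\<close> by
    \<open>B\<close>.\<close>
  define B where "B = g y0 * dist p s / (g y0 - 1)"
  have in_ball: "y \<in> cball p B" if "g y0 \<le> g y" for y
  proof -
    have "g y0 * (dist y p - dist p s) \<le> g y0 * far_dist S y"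
      using g0 far_dist_ge[OF S(1) \<open>s \<in> S\<close>, of y] dist_triangle[of y p s]
      by (intro mult_left_mono) (auto simp: dist_commute)
    also have "\<dots> \<le> dist y p"
      using that far_dist_pos[OF S, of y] by (simp add: g_def[of y] divide_simps mult.commute)
    finally have "(g y0 - 1) * dist y p \<le> g y0 * dist p s"
      by (simp add: algebra_simps)
    then show ?thesis
      using g0 by (simp add: B_def divide_simps dist_commute mult.commute)
  qed
  have "continuous_on (cball p B) g"
    unfolding g_def using far_dist_pos[OF S] \<open>S \<noteq> {}\<close> S
    by (intro continuous_intros continuous_on_far_dist) (auto simp: less_imp_neq[symmetric])
  then obtain x where x: "x \<in> cball p B" "\<And>y. y \<in> cball p B \<Longrightarrow> g y \<le> g x"
    using continuous_attains_sup[OF compact_cball, of p B g] in_ball[of y0] by blast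
  then have "g y \<le> g x" for y
    using in_ball[of y] in_ball[of y0] x(2)[of y] x(2)[of y0] by linarith
  then show ?thesis
    using g0 unfolding g_def by (meson less_le_trans)
qed

text \<open>
  If \<open>z\<close> were outside the hull of the farthest points, moving \<open>x\<close> along a separating direction
  would increase the ratio.
\<close>

lemma maximizer_is_inversion_centre:
  assumes S: "finite S" "card S \<ge> 2"
    and gt: "1 < dist x p / far_dist S x"
    and max: "\<And>y. dist y p / far_dist S y \<le> dist x p / far_dist S x"
  shows "\<exists>z. z \<in> convex hull far_set S x - far_set S x \<and> z \<noteq> x \<and> p = far_inversion S x z"
proof -
  define l where "l = dist x p / far_dist S x"
  define R where "R = far_dist S x"
  \<comment> \<open>Inversion is an involution, so the preimage of \<open>p\<close> is its own image
    under the inversion; the factor is \<open>R\<^sup>2 / (l * R)\<^sup>2\<close>.\<close>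
  define z where "z = x + (1 / l\<^sup>2) *\<^sub>R (p - x)"
  have "1 < l" using gt by (simp add: l_def)
  have "0 < R" unfolding R_def by (rule far_dist_pos[OF S])
  have lR: "dist x p = l * R"
    using \<open>0 < R\<close> by (simp add: l_def R_def)
  have xz: "dist x z = R / l"
    using \<open>1 < l\<close> lR by (simp add: z_def dist_norm norm_minus_commute power2_eq_square)
  have "S \<noteq> {}" using S by auto
  have "z \<noteq> x"
    using xz \<open>0 < R\<close> \<open>1 < l\<close> by auto
  moreover have "z \<notin> far_set S x"
  proof -
    have "R / l < R"
      using \<open>0 < R\<close> \<open>1 < l\<close> by (simp add: divide_simps)
    then show ?thesis
      using xz by (auto simp: far_set_def R_def)
  qed
  moreover have "p = far_inversion S x z"
  proof -
    have "R\<^sup>2 / (dist x z)\<^sup>2 = l\<^sup>2"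
      using xz \<open>0 < R\<close> \<open>1 < l\<close> by (simp add: power_divide)
    then show ?thesis
      using \<open>1 < l\<close> by (simp add: far_inversion_def R_def z_def)
  qed
  moreover have "z \<in> convex hull far_set S x"
  proof (rule ccontr)
    assume "z \<notin> convex hull far_set S x"
    moreover have "closed (convex hull far_set S x)"
      using S(1) by (simp add: compact_imp_closed finite_imp_compact_convex_hull far_set_def)
    ultimately obtain w b where w: "w \<bullet> z < b" "\<And>q. q \<in> convex hull far_set S x \<Longrightarrow> b < w \<bullet> q"
      using separating_hyperplane_closed_point[of "convex hull far_set S x" z] by auto
    \<comment> \<open>Moving slightly along \<open>w\<close> beats the ratio \<open>l\<close>
      against each point of \<open>S\<close>: to first order for the farthest points, where equality
      holds at \<open>x\<close>, and by continuity for the others, where the inequality is already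
      strict.\<close>
    have "\<forall>\<^sub>F t in at_right 0. l * dist (x + t *\<^sub>R w) q < dist (x + t *\<^sub>R w) p" if "q \<in> S" for q
    proof (cases "q \<in> far_set S x")
      case True
      define d where "d = w \<bullet> (q - z)"
      have "0 < d"
        using w(1) w(2)[of q] True hull_inc[of q "far_set S x" convex] by (simp add: d_def inner_diff_right)
      then have "0 < 2 * l\<^sup>2 * d"
        using \<open>1 < l\<close> by simp
      \<comment> \<open>This is \<open>(dist (x + t *\<^sub>R w) p)\<^sup>2 - l\<^sup>2 * (dist (x +
        t *\<^sub>R w) q)\<^sup>2\<close> divided by \<open>t\<close>; its limit is positive since
        \<open>w\<close> separates \<open>z\<close> from \<open>q\<close>.\<close>
      have "((\<lambda>t. 2 * l\<^sup>2 * d + t * ((1 - l\<^sup>2) * (w \<bullet> w))) \<longlongrightarrow> 2 * l\<^sup>2 * d + 0 * ((1 - l\<^sup>2) * (w \<bullet> w))) (at_right 0)"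
        by (intro tendsto_intros)
      then have "\<forall>\<^sub>F t in at_right 0. 0 < 2 * l\<^sup>2 * d + t * ((1 - l\<^sup>2) * (w \<bullet> w))"
        using \<open>0 < 2 * l\<^sup>2 * d\<close> by (intro order_tendstoD(1)[where y = "2 * l\<^sup>2 * d + 0 * ((1 - l\<^sup>2) * (w \<bullet> w))"]) auto
      moreover have "\<forall>\<^sub>F t in at_right 0. 0 < (t::real)"
        by (simp add: eventually_at_right_less)
      ultimately show ?thesis
      proof eventually_elim
        case (elim t)
        have px: "p - x = l\<^sup>2 *\<^sub>R (z - x)"
          using \<open>1 < l\<close> by (simp add: z_def)
        have "(dist x q)\<^sup>2 = R\<^sup>2"
          using True by (simp add: far_set_def R_def)
        then have q0: "(dist x p)\<^sup>2 = l\<^sup>2 * (dist x q)\<^sup>2"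
          using lR by (simp add: power_mult_distrib)
        have sh: "(dist (x + t *\<^sub>R w) v)\<^sup>2 = (dist x v)\<^sup>2 - 2 * t * (w \<bullet> (v - x)) + t\<^sup>2 * (w \<bullet> w)" for v
          unfolding dist_sq by (simp add: inner_diff inner_add inner_commute power2_eq_square algebra_simps)
        have "(dist (x + t *\<^sub>R w) p)\<^sup>2 - l\<^sup>2 * (dist (x + t *\<^sub>R w) q)\<^sup>2 =
            t * (2 * l\<^sup>2 * d + t * ((1 - l\<^sup>2) * (w \<bullet> w)))"
        proof -
          have wp: "w \<bullet> (p - x) = l\<^sup>2 * (w \<bullet> (q - x) - d)"
            unfolding px d_def by (simp add: inner_diff_right)
          show ?thesis
            unfolding sh q0 wp by (simp add: power2_eq_square algebra_simps)
        qed
        also have "\<dots> > 0"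
          using elim by simp
        finally have "(l * dist (x + t *\<^sub>R w) q)\<^sup>2 < (dist (x + t *\<^sub>R w) p)\<^sup>2"
          by (simp add: power_mult_distrib)
        then show ?case
          using power_less_imp_less_base zero_le_dist by blast
      qed
    next
      case False
      then have "dist x q < R"
        using that far_dist_ge[OF S(1) that, of x] by (auto simp: far_set_def R_def)
      then have "0 < dist x p - l * dist x q"
        using lR \<open>1 < l\<close> by simp
      moreover have "((\<lambda>t. dist (x + t *\<^sub>R w) p - l * dist (x + t *\<^sub>R w) q) \<longlongrightarrow>
          dist (x + 0 *\<^sub>R w) p - l * dist (x + 0 *\<^sub>R w) q) (at_right 0)"
        by (intro tendsto_intros)
      ultimately have "\<forall>\<^sub>F t in at_right 0. 0 < dist (x + t *\<^sub>R w) p - l * dist (x + t *\<^sub>R w) q"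
        by (intro order_tendstoD(1)[where y = "dist (x + 0 *\<^sub>R w) p - l * dist (x + 0 *\<^sub>R w) q"]) auto
      then show ?thesis by simp
    qed
    then have "\<forall>\<^sub>F t in at_right 0. \<forall>q\<in>S. l * dist (x + t *\<^sub>R w) q < dist (x + t *\<^sub>R w) p"
      using S(1) by (simp add: eventually_ball_finite)
    then obtain t where t: "\<forall>q\<in>S. l * dist (x + t *\<^sub>R w) q < dist (x + t *\<^sub>R w) p"
      using eventually_happens'[OF trivial_limit_at_right_real] by blast
    define y where "y = x + t *\<^sub>R w"
    obtain q where "q \<in> S" "dist y q = far_dist S y"
      using far_set_nonempty[OF S(1) \<open>S \<noteq> {}\<close>] by (auto simp: far_set_def)
    then have "l * far_dist S y < dist y p"
      using t by (auto simp: y_def)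
    then have "l < dist y p / far_dist S y"
      using far_dist_pos[OF S, of y] by (simp add: divide_simps)
    then show False
      using max[of y] by (simp add: l_def)
  qed
  ultimately show ?thesis by blast
qed

subsection \<open>Cells and edges\<close>

text \<open>A hull vertex lies outside the hull of the remaining points, so there are arbitrarily
  distant points from which it is the strictly farthest. In particular no cell is empty.\<close>

lemma FV_unbounded:
  assumes "finite S" "card S \<ge> 2" "a \<in> S" "a extreme_point_of (convex hull S)"
  shows "\<exists>y\<in>FV S a. B < norm y"
proof -
  have "S - {a} \<noteq> {}"
  proof
    assume "S - {a} = {}"
    then have "S = {a}" using assms(3) by auto
    then show False using assms(2) by simp
  qed
  then show ?thesis
    using far_point_exists[of "S - {a}" a B] notin_convex_hull_minus_extreme[OF assms(4)] assms(1)
    by (auto simp: FV_def)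
qed

lemma open_FV: "finite S \<Longrightarrow> open (FV S a)"
proof -
  assume "finite S"
  have "FV S a = (\<Inter>b\<in>S - {a}. {y. dist y b < dist y a})"
    by (auto simp: FV_def)
  also have "open \<dots>"
    using \<open>finite S\<close> by (intro open_INT) (auto intro!: open_Collect_less continuous_intros)
  finally show ?thesis .
qed

lemma in_far_set_iff:
  assumes "finite S" "a \<in> S"
  shows "a \<in> far_set S y \<longleftrightarrow> (\<forall>b\<in>S. dist y b \<le> dist y a)"
proof
  assume "a \<in> far_set S y"
  then show "\<forall>b\<in>S. dist y b \<le> dist y a"
    using far_dist_ge[OF assms(1)] by (auto simp: far_set_def)
next
  assume "\<forall>b\<in>S. dist y b \<le> dist y a"
  then have "far_dist S y = dist y a"
    unfolding far_dist_def using assms by (intro Max_eqI) auto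
  then show "a \<in> far_set S y"
    using assms(2) by (simp add: far_set_def)
qed

text \<open>Take \<open>y\<close> satisfying the weak inequalities and \<open>z\<close> in the cell.
  The inequalities are affine and strict at \<open>z\<close>, so they are strict on the open segment
  from \<open>y\<close> to \<open>z\<close>, which has \<open>y\<close> in its closure.\<close>

lemma closure_FV:
  assumes "finite S" "a \<in> S" "FV S a \<noteq> {}"
  shows "closure (FV S a) = {y. a \<in> far_set S y}"
proof
  have "{y. a \<in> far_set S y} = (\<Inter>b\<in>S. {y. dist y b \<le> dist y a})"
    using in_far_set_iff[OF assms(1,2)] by auto
  also have "closed \<dots>"
    by (intro closed_INT ballI closed_Collect_le continuous_intros)
  finally have "closed {y. a \<in> far_set S y}" .
  moreover have "FV S a \<subseteq> {y. a \<in> far_set S y}"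
  proof
    fix y assume "y \<in> FV S a"
    then have "dist y b \<le> dist y a" if "b \<in> S" for b
      using that by (cases "b = a") (auto simp: FV_def intro: less_imp_le)
    then show "y \<in> {y. a \<in> far_set S y}"
      by (simp add: in_far_set_iff[OF assms(1,2)])
  qed
  ultimately show "closure (FV S a) \<subseteq> {y. a \<in> far_set S y}"
    by (rule closure_minimal[rotated])
next
  obtain z where z: "z \<in> FV S a" using assms(3) by auto
  show "{y. a \<in> far_set S y} \<subseteq> closure (FV S a)"
  proof (safe, cases)
    fix y assume "y = z"
    then show "y \<in> closure (FV S a)"
      using z closure_subset by auto
  next
    fix y assume y: "a \<in> far_set S y" and "y \<noteq> z"
    have "open_segment y z \<subseteq> FV S a"
    proof
      fix w assume "w \<in> open_segment y z"
      then obtain t where t: "0 < t" "t < 1" "w = (1 - t) *\<^sub>R y + t *\<^sub>R z"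
        by (auto simp: in_segment)
      have "dist w b < dist w a" if "b \<in> S - {a}" for b
      proof -
        have "\<not> dist y a < dist y b"
          using y that in_far_set_iff[OF assms(1,2), of y] by (auto simp: not_less)
        then have 1: "2 * ((a - b) \<bullet> y) \<le> a \<bullet> a - b \<bullet> b"
          by (simp add: dist_less_iff_inner inner_diff_left)
        have "dist z b < dist z a"
          using z that by (auto simp: FV_def)
        then have 2: "2 * ((a - b) \<bullet> z) < a \<bullet> a - b \<bullet> b"
          by (simp add: dist_less_iff_inner)
        have "2 * ((a - b) \<bullet> w) = (1 - t) * (2 * ((a - b) \<bullet> y)) + t * (2 * ((a - b) \<bullet> z))"
          by (simp add: t(3) inner_add_right)
        also have "\<dots> < (1 - t) * (a \<bullet> a - b \<bullet> b) + t * (a \<bullet> a - b \<bullet> b)"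
          using t 1 2 by (intro add_le_less_mono mult_left_mono mult_strict_left_mono) auto
        finally show ?thesis
          by (simp add: dist_less_iff_inner algebra_simps)
      qed
      then show "w \<in> FV S a"
        by (auto simp: FV_def)
    qed
    moreover have "y \<in> closure (open_segment y z)"
      using \<open>y \<noteq> z\<close> by simp
    ultimately show "y \<in> closure (FV S a)"
      using closure_mono by blast
  qed
qed

text \<open>The cells are open, so each frontier is the closure without the cell, and a tie between
  \<open>a\<close> and \<open>b\<close> keeps a point out of both cells. This replaces frontiers by
  farthest sets from here on.\<close>

lemma edge_eq:
  assumes "finite S" "card S \<ge> 2" "\<forall>x\<in>S. x extreme_point_of (convex hull S)"
    and "a \<in> S" "b \<in> S" "a \<noteq> b"
  shows "edge S a b = {y. a \<in> far_set S y \<and> b \<in> far_set S y}"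
proof -
  have front: "frontier (FV S q) = {y. q \<in> far_set S y} - FV S q" if "q \<in> S" for q
  proof -
    have "FV S q \<noteq> {}"
      using FV_unbounded[OF assms(1,2) that] assms(3) that by auto
    then show ?thesis
      using closure_FV[OF assms(1) that] open_FV[OF assms(1)]
      by (simp add: frontier_def interior_open)
  qed
  have "y \<notin> FV S a \<and> y \<notin> FV S b" if "a \<in> far_set S y" "b \<in> far_set S y" for y
    using that assms(4-6) unfolding FV_def far_set_def by force
  then show ?thesis
    using front assms(4,5) by (auto simp: edge_def)
qed

lemma fv_edges_iff:
  assumes "finite S" "card S \<ge> 2" "\<forall>x\<in>S. x extreme_point_of (convex hull S)"
  shows "E \<in> fv_edges S \<longleftrightarrow> E \<noteq> {} \<and>
    (\<exists>a\<in>S. \<exists>b\<in>S. a \<noteq> b \<and> E = {y. a \<in> far_set S y \<and> b \<in> far_set S y})"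
proof
  assume "E \<in> fv_edges S"
  then obtain a b where ab: "a \<in> S" "b \<in> S" "a \<noteq> b" "E = edge S a b" "edge S a b \<noteq> {}"
    unfolding fv_edges_def by blast
  moreover have "E = {y. a \<in> far_set S y \<and> b \<in> far_set S y}"
    using ab edge_eq[OF assms ab(1-3)] by simp
  ultimately show "E \<noteq> {} \<and> (\<exists>a\<in>S. \<exists>b\<in>S. a \<noteq> b \<and> E = {y. a \<in> far_set S y \<and> b \<in> far_set S y})"
    by blast
next
  assume "E \<noteq> {} \<and> (\<exists>a\<in>S. \<exists>b\<in>S. a \<noteq> b \<and> E = {y. a \<in> far_set S y \<and> b \<in> far_set S y})"
  then obtain a b where ab: "a \<in> S" "b \<in> S" "a \<noteq> b" "E \<noteq> {}"
      "E = {y. a \<in> far_set S y \<and> b \<in> far_set S y}"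
    by blast
  then have "E = edge S a b"
    using edge_eq[OF assms ab(1-3)] by simp
  moreover have "E \<subseteq> FVB S"
    unfolding ab(5) FVB_iff subset_iff mem_Collect_eq using ab(3) by blast
  ultimately show "E \<in> fv_edges S"
    using ab(1-4) unfolding fv_edges_def by blast
qed

lemma finite_fv_edges:
  assumes "finite S"
  shows "finite (fv_edges S)"
proof (rule finite_subset)
  show "fv_edges S \<subseteq> (\<lambda>(a, b). edge S a b) ` (S \<times> S)"
    by (auto simp: fv_edges_def)
qed (use assms in auto)

lemma Union_fv_edges:
  assumes "finite S" "card S \<ge> 2" "\<forall>x\<in>S. x extreme_point_of (convex hull S)"
  shows "\<Union>(fv_edges S) = FVB S"
proof
  show "\<Union>(fv_edges S) \<subseteq> FVB S"
    by (auto simp: fv_edges_def)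
  show "FVB S \<subseteq> \<Union>(fv_edges S)"
  proof
    fix x assume "x \<in> FVB S"
    then obtain a b where ab: "a \<in> far_set S x" "b \<in> far_set S x" "a \<noteq> b"
      by (auto simp: FVB_iff)
    then have "a \<in> S" "b \<in> S"
      by (auto simp: far_set_def)
    then have "{y. a \<in> far_set S y \<and> b \<in> far_set S y} \<in> fv_edges S"
      using ab by (subst fv_edges_iff[OF assms]) blast
    then show "x \<in> \<Union>(fv_edges S)"
      using ab by blast
  qed
qed

text \<open>Otherwise the Voronoi boundary fits in a disc. The complement of the disc is connected
  in the plane, yet it would be covered by disjoint open cells, at least two of which are unbounded.
  The lemma makes infinity feasible.\<close>

lemma unbounded_fv_edge:
  assumes "finite S" "card S \<ge> 2" "\<forall>x\<in>S. x extreme_point_of (convex hull S)"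
  shows "\<exists>E\<in>fv_edges S. \<not> bounded E"
proof (rule ccontr)
  assume "\<not> ?thesis"
  then have "bounded (\<Union>(fv_edges S))"
    using bounded_Union[OF finite_fv_edges[OF assms(1)]] by blast
  then have "bounded (FVB S)"
    unfolding Union_fv_edges[OF assms] .
  then obtain B where "\<And>w. w \<in> FVB S \<Longrightarrow> norm w \<le> B"
    unfolding bounded_iff by blast
  then have B: "FVB S \<subseteq> cball 0 B"
    by auto
  have conn: "connected (- cball (0::real^2) B)"
    by (intro connected_complement_bounded_convex) auto
  obtain a b where ab: "a \<in> S" "b \<in> S" "a \<noteq> b"
    using assms(2) card_le_Suc0_iff_eq[OF assms(1)] by auto
  obtain y where y: "y \<in> FV S a" "B < norm y"
    using FV_unbounded[OF assms(1,2) ab(1), of B] assms(3) ab by auto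
  obtain z where z: "z \<in> FV S b" "B < norm z"
    using FV_unbounded[OF assms(1,2) ab(2), of B] assms(3) ab by auto
  define V where "V = (\<Union>q\<in>S - {a}. FV S q)"
  have disj: "FV S a \<inter> V = {}"
  proof -
    have False if "w \<in> FV S a" "w \<in> FV S q" "q \<in> S - {a}" for w q
    proof -
      have "dist w q < dist w a" "dist w a < dist w q"
        using that ab(1) by (auto simp: FV_def)
      then show False by simp
    qed
    then show ?thesis
      unfolding V_def by blast
  qed
  have "- cball 0 B \<subseteq> FV S a \<union> V"
  proof
    fix w assume "w \<in> - cball (0::real^2) B"
    then have "w \<notin> FVB S" using B by auto
    obtain q where q: "q \<in> far_set S w"
      using far_set_nonempty[OF assms(1), of w] ab by auto
    have "dist w q' < dist w q" if "q' \<in> S - {q}" for q'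
    proof -
      have "q' \<notin> far_set S w"
        using \<open>w \<notin> FVB S\<close> q that by (auto simp: FVB_iff)
      then show ?thesis
        using q that far_dist_ge[OF assms(1), of q' w] by (auto simp: far_set_def)
    qed
    then have "w \<in> FV S q"
      by (auto simp: FV_def)
    moreover have "q \<in> S"
      using q by (simp add: far_set_def)
    ultimately show "w \<in> FV S a \<union> V"
      by (auto simp: V_def)
  qed
  moreover have "open (FV S a)" "open V"
    using open_FV[OF assms(1)] by (auto simp: V_def)
  moreover have "FV S a \<inter> - cball 0 B \<noteq> {}" "V \<inter> - cball 0 B \<noteq> {}"
    using y z ab by (auto simp: V_def)
  ultimately show False
    using connectedD[OF conn, of "FV S a" V] disj by blast
qed

section \<open>Feasible points and the unique optimum\<close>

lemma feasible_iff:
  assumes "finite S" "card S \<ge> 2" "\<forall>x\<in>S. x extreme_point_of (convex hull S)"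
  shows "(\<exists>E\<in>fv_edges S. v \<in> with_infinity E) \<longleftrightarrow> (case v of None \<Rightarrow> True | Some x \<Rightarrow> x \<in> FVB S)"
proof (cases v)
  case None
  then show ?thesis
    using unbounded_fv_edge[OF assms] by (auto simp: with_infinity_def)
next
  case (Some x)
  then show ?thesis
    unfolding Union_fv_edges[OF assms, symmetric] by (auto simp: with_infinity_def)
qed

lemma is_arg_max_iff_strict_max:
  fixes f :: "'a \<Rightarrow> 'b::order"
  assumes "P w" "\<And>v. v \<noteq> w \<Longrightarrow> f v < f w"
  shows "is_arg_max f P v \<longleftrightarrow> v = w"
proof
  assume "is_arg_max f P v"
  then have "\<not> f v < f w"
    using assms(1) by (simp add: is_arg_max_def)
  then show "v = w"
    using assms(2) by blast
next
  assume "v = w"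
  moreover have "\<not> f w < f y" for y
    using assms(2)[of y] by (cases "y = w") auto
  ultimately show "is_arg_max f P v"
    using assms(1) by (simp add: is_arg_max_def)
qed

text \<open>A single farthest point would leave no room for \<open>z\<close>, since its hull has no
  other point; hence \<open>x\<close> is feasible. It is the strict maximizer over the whole plane,
  and its value exceeds the value 1 at infinity.\<close>

lemma optimal_far_inversion:
  assumes S: "finite S" "card S \<ge> 2" "\<forall>x\<in>S. x extreme_point_of (convex hull S)"
    and z: "z \<in> convex hull far_set S x - far_set S x" "z \<noteq> x" "p = far_inversion S x z"
  shows "x \<in> FVB S" and "optimal S p v \<longleftrightarrow> v = Some x"
proof -
  show x: "x \<in> FVB S"
  proof (rule ccontr)
    assume "x \<notin> FVB S"
    moreover obtain q where "q \<in> far_set S x"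
      using far_set_nonempty[OF S(1), of x] S(2) by (cases "S = {}") auto
    ultimately have "far_set S x = {q}"
      by (auto simp: FVB_iff)
    then show False using z(1) by simp
  qed
  have less: "objective S p w < objective S p (Some x)" if "w \<noteq> Some x" for w
    using far_inversion_optimal[OF S(1,2) z] that by (cases w) auto
  show "optimal S p v \<longleftrightarrow> v = Some x"
    unfolding optimal_def feasible_iff[OF S]
    by (rule is_arg_max_iff_strict_max) (use x less in simp_all)
qed

text \<open>Such a \<open>p\<close> is strictly inside every circle that encloses \<open>S\<close>,
  so all finite values stay below the value 1 at infinity.\<close>

lemma optimal_in_hull:
  assumes S: "finite S" "card S \<ge> 2" "\<forall>x\<in>S. x extreme_point_of (convex hull S)"
    and p: "p \<in> convex hull S - S"
  shows "optimal S p v \<longleftrightarrow> v = None"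
proof -
  have lt: "dist x p < far_dist S x" for x
    using convex_hull_dist_less[of S x "far_dist S x" p] far_dist_ge[OF S(1)] p by auto
  have less: "objective S p w < objective S p None" if "w \<noteq> None" for w
  proof (cases w)
    case (Some x)
    then show ?thesis
      using lt[of x] far_dist_pos[OF S(1,2), of x] by simp
  qed (use that in simp)
  show ?thesis
    unfolding optimal_def feasible_iff[OF S]
    by (rule is_arg_max_iff_strict_max) (use less in simp_all)
qed

subsection \<open>Nodes and open edges\<close>

text \<open>A quarter turn: \<open>rot (b - a)\<close> points along the perpendicular bisector of
  \<open>a\<close> and \<open>b\<close>, and \<open>u \<bullet> rot w\<close> is the determinant of
  the pair \<open>w\<close>, \<open>u\<close>.\<close>

definition rot :: "real^2 \<Rightarrow> real^2" where
  "rot w = vector [- (w $ 2), w $ 1]"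

lemma inner_real2: "(u::real^2) \<bullet> w = u $ 1 * w $ 1 + u $ 2 * w $ 2"
  by (simp add: inner_vec_def sum_2)

lemma inner_rot: "u \<bullet> rot w = u $ 2 * w $ 1 - u $ 1 * w $ 2"
  by (simp add: inner_real2 rot_def)

lemma rot_eq_0_iff: "rot w = 0 \<longleftrightarrow> w = 0"
  by (auto simp: rot_def vec_eq_iff forall_2)

lemma parallel_of_inner_rot_eq_0:
  assumes "u \<bullet> rot w = 0" "w \<noteq> 0"
  shows "\<exists>s. u = s *\<^sub>R w"
proof
  have *: "u $ 2 * w $ 1 = u $ 1 * w $ 2"
    using assms(1) by (simp add: inner_rot)
  have "0 < w \<bullet> w" using assms(2) by simp
  have "u $ 1 * (w \<bullet> w) = (u \<bullet> w) * w $ 1" "u $ 2 * (w \<bullet> w) = (u \<bullet> w) * w $ 2"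
    using * by (simp_all add: inner_real2) algebra+
  then show "u = ((u \<bullet> w) / (w \<bullet> w)) *\<^sub>R w"
    using \<open>0 < w \<bullet> w\<close> by (simp add: vec_eq_iff forall_2 divide_simps)
qed

text \<open>A line meets a circle at most twice: for \<open>d = a + s *\<^sub>R m\<close> the two
  distance equations give \<open>s = s * s\<close>, so \<open>d\<close> is \<open>a\<close> or
  \<open>b\<close>.\<close>

lemma equidistant_not_collinear:
  assumes "dist x a = dist x b" "dist x a = dist x d" "a \<noteq> b" "a \<noteq> d" "b \<noteq> d"
  shows "(d - a) \<bullet> rot (b - a) \<noteq> 0"
proof
  assume "(d - a) \<bullet> rot (b - a) = 0"
  then obtain s where "d - a = s *\<^sub>R (b - a)"
    using parallel_of_inner_rot_eq_0[of "d - a" "b - a"] assms(3) by auto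
  define m where "m = b - a"
  have b: "b = a + m" by (simp add: m_def)
  have d: "d = a + s *\<^sub>R m"
    using \<open>d - a = s *\<^sub>R (b - a)\<close> by (simp add: m_def algebra_simps)
  have "m \<bullet> m \<noteq> 0" using assms(3) by (simp add: m_def)
  have "2 * (m \<bullet> x) = 2 * (a \<bullet> m) + m \<bullet> m"
    using assms(1) by (simp add: dist_eq_iff_inner b inner_add inner_commute)
  moreover have "2 * (s * (m \<bullet> x)) = 2 * (s * (a \<bullet> m)) + s * (s * (m \<bullet> m))"
    using assms(2) by (simp add: dist_eq_iff_inner d inner_add inner_commute)
  ultimately have "s * (m \<bullet> m) = s * s * (m \<bullet> m)"
    by algebra
  then have "s = 0 \<or> s = 1"
    using \<open>m \<bullet> m \<noteq> 0\<close> by auto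
  then show False
    using assms(4,5) b d by auto
qed

text \<open>The difference of two circumcentres is orthogonal to two independent sides of the
  triangle, hence zero.\<close>

lemma equidistant_unique:
  assumes "dist x a = dist x b" "dist x a = dist x d" "a \<noteq> b" "a \<noteq> d" "b \<noteq> d"
    and "dist y a = dist y b" "dist y a = dist y d"
  shows "x = (y::real^2)"
proof -
  define e m n where emn: "e = x - y" "m = b - a" "n = d - a"
  have D: "n $ 2 * m $ 1 - n $ 1 * m $ 2 \<noteq> 0"
    using equidistant_not_collinear[OF assms(1-5)] by (simp add: inner_rot emn)
  have "m \<bullet> e = 0" "n \<bullet> e = 0"
    using assms(1,2,6,7)[unfolded dist_eq_iff_inner] by (simp_all add: emn inner_diff_right)
  then have "m $ 1 * e $ 1 + m $ 2 * e $ 2 = 0" "n $ 1 * e $ 1 + n $ 2 * e $ 2 = 0"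
    by (simp_all add: inner_real2)
  then have "(n $ 2 * m $ 1 - n $ 1 * m $ 2) * e $ 1 = 0" "(n $ 2 * m $ 1 - n $ 1 * m $ 2) * e $ 2 = 0"
    by algebra+
  then have "e = 0"
    using D by (simp add: vec_eq_iff forall_2)
  then show ?thesis by (simp add: emn)
qed

text \<open>Along the bisector the lead of \<open>a\<close> over \<open>q\<close> changes linearly.
  The slope vanishes for \<open>q = b\<close>, and for a third point its sign tells in which
  direction that point falls behind.\<close>

lemma dist_rot_shift:
  "(dist (x + s *\<^sub>R rot (b - a)) a)\<^sup>2 - (dist (x + s *\<^sub>R rot (b - a)) q)\<^sup>2 =
    (dist x a)\<^sup>2 - (dist x q)\<^sup>2 + 2 * s * ((q - a) \<bullet> rot (b - a))"
  unfolding dist_sq by (simp add: inner_add_left inner_diff_left inner_commute algebra_simps)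

lemma dist_rot_shift_eq:
  assumes "dist x a = dist x b"
  shows "dist (x + s *\<^sub>R rot (b - a)) a = dist (x + s *\<^sub>R rot (b - a)) b"
proof -
  have "(b - a) \<bullet> rot (b - a) = 0"
    by (simp add: inner_rot)
  then have "(dist (x + s *\<^sub>R rot (b - a)) a)\<^sup>2 = (dist (x + s *\<^sub>R rot (b - a)) b)\<^sup>2"
    using dist_rot_shift[of x s b a b] assms by simp
  then show ?thesis by simp
qed

lemma small_shift:
  fixes x u :: "'a::real_normed_vector"
  assumes "open U" "x \<in> U"
  shows "\<exists>t>0. \<forall>s. \<bar>s\<bar> \<le> t \<longrightarrow> x + s *\<^sub>R u \<in> U"
proof -
  obtain e where e: "0 < e" "ball x e \<subseteq> U"
    using assms open_contains_ball by blast
  define t where "t = e / (norm u + 1)"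
  have "0 < norm u + 1"
    by (simp add: add_nonneg_pos)
  then have t: "0 < t" "t * (norm u + 1) = e"
    using e by (simp_all add: t_def)
  have "x + s *\<^sub>R u \<in> U" if "\<bar>s\<bar> \<le> t" for s
  proof -
    have "\<bar>s\<bar> * norm u \<le> t * norm u"
      using that by (simp add: mult_right_mono)
    also have "\<dots> < e"
      using t by (simp add: distrib_left)
    finally show ?thesis
      using e by (auto simp: dist_norm)
  qed
  then show ?thesis using t by blast
qed

lemma open_closer_set: "finite T \<Longrightarrow> open {y. \<forall>q\<in>T. dist y q < dist y (a::real^2)}"
proof -
  assume "finite T"
  have "{y. \<forall>q\<in>T. dist y q < dist y a} = (\<Inter>q\<in>T. {y. dist y q < dist y a})"
    by auto
  also have "open \<dots>"
    using \<open>finite T\<close> by (intro open_INT) (auto intro!: open_Collect_less continuous_intros)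
  finally show ?thesis .
qed

lemma fv_nodesI:
  assumes "E \<in> fv_edges S" "F \<in> fv_edges S" "E \<noteq> F" "v \<in> with_infinity E \<inter> with_infinity F"
  shows "v \<in> fv_nodes S"
  using assms unfolding fv_nodes_def by blast

text \<open>
  Moving off \<open>x\<close> along the bisector of \<open>a\<close> and \<open>b\<close>, away from \<open>d\<close>, leaves the edges of \<open>d\<close> but
  not that of \<open>a\<close> and \<open>b\<close>; so the edges meeting at \<open>x\<close> are not all equal.
\<close>

lemma three_farthest_is_node:
  assumes S: "finite S" "card S \<ge> 2" "\<forall>x\<in>S. x extreme_point_of (convex hull S)"
    and I: "far_set S x = {a, b, d}" "a \<noteq> b" "a \<noteq> d" "b \<noteq> d"
  shows "Some x \<in> fv_nodes S"
proof -
  let ?E = "\<lambda>a b. {y. a \<in> far_set S y \<and> b \<in> far_set S y}"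
  have far: "{a, b, d} \<subseteq> S" "dist x a = far_dist S x" "dist x b = far_dist S x" "dist x d = far_dist S x"
    using I(1) by (auto simp: far_set_def)
  define u where "u = rot (b - a)"
  define k where "k = (d - a) \<bullet> u"
  have "k \<noteq> 0"
    unfolding k_def u_def using far I by (intro equidistant_not_collinear[of x]) auto
  define U where "U = {y. \<forall>q\<in>S - {a, b, d}. dist y q < dist y a}"
  have "open U"
    unfolding U_def using S(1) by (intro open_closer_set) auto
  moreover have "x \<in> U"
    using far_set_eq_iff[OF S(1) far(1), of a x] I(1) by (simp add: U_def)
  ultimately obtain t where t: "0 < t" "\<forall>s. \<bar>s\<bar> \<le> t \<longrightarrow> x + s *\<^sub>R u \<in> U"
    using small_shift by blast
  \<comment> \<open>The factor \<open>sgn k\<close> selects the direction in which \<open>d\<close>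
    stops being farthest.\<close>
  define y where "y = x + (t * sgn k) *\<^sub>R u"
  have "y \<in> U"
    using t \<open>k \<noteq> 0\<close> by (auto simp: y_def abs_mult abs_sgn_eq)
  have ab: "dist y a = dist y b"
    unfolding y_def u_def using far by (intro dist_rot_shift_eq) auto
  have "(dist y a)\<^sup>2 - (dist y d)\<^sup>2 = 2 * t * \<bar>k\<bar>"
    using dist_rot_shift[of x "t * sgn k" b a d] far
    by (simp add: y_def u_def[symmetric] k_def[symmetric] sgn_mult_self_eq abs_sgn mult.assoc)
  also have "\<dots> > 0" using t \<open>k \<noteq> 0\<close> by simp
  finally have "(dist y d)\<^sup>2 < (dist y a)\<^sup>2"
    by (simp only: diff_gt_0_iff_gt)
  then have d: "dist y d < dist y a"
    by (rule power2_less_imp_less) simp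
  have "far_set S y = {a, b}"
    using far_set_eq_iff[OF S(1), of "{a, b}" a y] far(1) ab d \<open>y \<in> U\<close> by (auto simp: U_def)
  then have "y \<in> ?E a b" "y \<notin> ?E a d"
    using I by auto
  then have neq: "?E a b \<noteq> ?E a d" by blast
  have x: "x \<in> ?E a b" "x \<in> ?E a d" using I by auto
  have edge: "?E q r \<in> fv_edges S" if "q \<in> S" "r \<in> S" "q \<noteq> r" "x \<in> ?E q r" for q r
    unfolding fv_edges_iff[OF S] using that by blast
  have edges: "?E a b \<in> fv_edges S" "?E a d \<in> fv_edges S"
    using edge[of a b] edge[of a d] x far(1) I by simp_all
  have "Some x \<in> with_infinity (?E a b) \<inter> with_infinity (?E a d)"
    using x by (simp add: with_infinity_def)
  then show ?thesis
    by (rule fv_nodesI[OF edges neq])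
qed

lemma not_extreme_of_shifts:
  fixes x u :: "'a::real_vector"
  assumes "x - u \<in> E" "x + u \<in> E" "u \<noteq> 0"
  shows "\<not> x extreme_point_of E"
proof -
  have "2 *\<^sub>R u = (x + u) - (x - u)"
    by (simp add: scaleR_2)
  moreover have "2 *\<^sub>R u \<noteq> 0"
    using assms(3) by simp
  ultimately have "x - u \<noteq> x + u"
    by (metis diff_self)
  moreover have "x = (1 - 1/2) *\<^sub>R (x - u) + (1/2) *\<^sub>R (x + u)"
    by (simp add: algebra_simps flip: scaleR_add_left)
  ultimately have "x \<in> open_segment (x - u) (x + u)"
    unfolding in_segment by (intro conjI exI[of _ "1/2"]) auto
  then show ?thesis
    using assms by (auto simp: extreme_point_of_def)
qed

lemma Some_in_open_edge: "Some x \<in> open_edge E \<longleftrightarrow> x \<in> E \<and> \<not> x extreme_point_of E"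
  by (auto simp: open_edge_def with_infinity_def endpoints_def)

text \<open>Near each \<open>x\<close> in \<open>X\<close> a short piece of the bisector stays in
  the edge and avoids the root, so \<open>x\<close> is the midpoint of a segment and no endpoint.
  Connectedness of \<open>X\<close> prevents it from meeting both halves of a split edge.\<close>

lemma two_farthest_in_open_edge:
  assumes S: "finite S" "card S \<ge> 2" "\<forall>x\<in>S. x extreme_point_of (convex hull S)"
    and I: "a \<noteq> b" "{a, b} \<subseteq> S"
    and X: "connected X" "X \<noteq> {}" "\<And>x. x \<in> X \<Longrightarrow> far_set S x = {a, b} \<and> x \<noteq> mec_center S"
  shows "\<exists>E\<in>dv_edges S. \<forall>x\<in>X. Some x \<in> open_edge E"
proof -
  define c where "c = mec_center S"
  define u where "u = rot (b - a)"
  define E where "E = {y. a \<in> far_set S y \<and> b \<in> far_set S y}"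
  have "u \<noteq> 0" using I(1) by (simp add: u_def rot_eq_0_iff)
  have XE: "X \<subseteq> E - {c}" using X(3) by (auto simp: E_def c_def)
  then have E: "E \<in> fv_edges S"
    unfolding fv_edges_iff[OF S] using I X(2) E_def by blast
  have shift: "\<exists>t>0. \<forall>s. \<bar>s\<bar> \<le> t \<longrightarrow> x + s *\<^sub>R u \<in> E - {c}" if xX: "x \<in> X" for x
  proof -
    define U where "U = {y. \<forall>q\<in>S - {a, b}. dist y q < dist y a} - {c}"
    have "open U"
      unfolding U_def using S(1) by (intro open_Diff open_closer_set) auto
    have x: "(\<forall>q\<in>{a, b}. dist x q = dist x a) \<and> (\<forall>q\<in>S - {a, b}. dist x q < dist x a)"
      using far_set_eq_iff[OF S(1) I(2), of a x] X(3)[OF xX] by simp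
    then have "x \<in> U" using X(3)[OF xX] by (simp add: U_def c_def)
    then obtain t where t: "0 < t" "\<forall>s. \<bar>s\<bar> \<le> t \<longrightarrow> x + s *\<^sub>R u \<in> U"
      using small_shift[OF \<open>open U\<close>] by blast
    have "x + s *\<^sub>R u \<in> E - {c}" if "\<bar>s\<bar> \<le> t" for s
    proof -
      have "dist (x + s *\<^sub>R u) a = dist (x + s *\<^sub>R u) b"
        unfolding u_def using x by (intro dist_rot_shift_eq) simp
      moreover have "x + s *\<^sub>R u \<in> U" using t that by blast
      ultimately have "far_set S (x + s *\<^sub>R u) = {a, b}" "x + s *\<^sub>R u \<noteq> c"
        using far_set_eq_iff[OF S(1) I(2), of a "x + s *\<^sub>R u"] by (auto simp: U_def)
      then show ?thesis by (simp add: E_def)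
    qed
    then show ?thesis using t by blast
  qed
  show ?thesis
  \<comment> \<open>In the first case the edge enters the division tree uncut: either the root is
    already a node, or it is not on this edge.\<close>
  proof (cases "Some c \<in> fv_nodes S \<or> c \<notin> E")
    case True
    then have "E \<in> dv_edges S"
      using E by (auto simp: dv_edges_def split_edge_def c_def intro!: bexI[of _ E])
    moreover have "Some x \<in> open_edge E" if xX: "x \<in> X" for x
    proof -
      obtain t where t: "0 < t" "\<forall>s. \<bar>s\<bar> \<le> t \<longrightarrow> x + s *\<^sub>R u \<in> E - {c}"
        using shift[OF xX] by blast
      then have "x - t *\<^sub>R u \<in> E" "x + t *\<^sub>R u \<in> E"
        using t(2)[rule_format, of t] t(2)[rule_format, of "- t"] by auto
      then show ?thesis
        using not_extreme_of_shifts[of x "t *\<^sub>R u" E] t(1) \<open>u \<noteq> 0\<close> XE xX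
        by (auto simp: Some_in_open_edge)
    qed
    ultimately show ?thesis by blast
  next
    case False
    obtain K where K: "K \<in> components (E - {c})" "X \<subseteq> K"
      using exists_component_superset[of X "E - {c}"] XE X(1,2) by blast
    have "insert c K \<in> split_edge c E"
      using False K by (auto simp: split_edge_def)
    then have "insert c K \<in> dv_edges S"
      using E False by (auto simp: dv_edges_def c_def)
    moreover have "Some x \<in> open_edge (insert c K)" if xX: "x \<in> X" for x
    proof -
      obtain t where t: "0 < t" "\<forall>s. \<bar>s\<bar> \<le> t \<longrightarrow> x + s *\<^sub>R u \<in> E - {c}"
        using shift[OF xX] by blast
      \<comment> \<open>The short segment through \<open>x\<close> is connected and avoids
        \<open>c\<close>, so it remains in the component \<open>K\<close> and shows that
        \<open>x\<close> is not extreme in the half edge.\<close>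
      define L where "L = (\<lambda>s. x + s *\<^sub>R u) ` {-t..t}"
      have "connected L"
        unfolding L_def by (intro connected_continuous_image continuous_intros) auto
      moreover have "L \<subseteq> E - {c}"
      proof
        fix y assume "y \<in> L"
        then obtain s where "y = x + s *\<^sub>R u" "s \<in> {-t..t}"
          unfolding L_def by blast
        moreover from this have "\<bar>s\<bar> \<le> t"
          by auto
        ultimately show "y \<in> E - {c}"
          using t(2) by blast
      qed
      moreover have "x \<in> L"
        using t(1) by (auto simp: L_def intro!: image_eqI[of _ _ 0])
      ultimately have "L \<subseteq> K"
        using components_maximal[OF K(1)] K(2) xX by blast
      moreover have "x + t *\<^sub>R u \<in> L" "x + (- t) *\<^sub>R u \<in> L"
        unfolding L_def using t(1) by (intro imageI, simp)+
      ultimately have "x - t *\<^sub>R u \<in> insert c K" "x + t *\<^sub>R u \<in> insert c K"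
        by auto
      then show ?thesis
        using not_extreme_of_shifts[of x "t *\<^sub>R u" "insert c K"] t(1) \<open>u \<noteq> 0\<close> K(2) xX
        by (auto simp: Some_in_open_edge)
    qed
    ultimately show ?thesis by blast
  qed
qed

subsection \<open>The regions\<close>

text \<open>
  The level sets of \<open>sector\<close> are the origin and four convex cones; they cut the plane minus a point
  into convex pieces.
\<close>

definition sector :: "real^2 \<Rightarrow> real" where
  "sector y = (if y $ 1 = 0 then 2 * sgn (y $ 2) else sgn (y $ 1))"

lemma sector_scale: "0 < r \<Longrightarrow> sector (r *\<^sub>R y) = sector y"
  by (simp add: sector_def sgn_mult)

lemma sector_eq_0_iff: "sector y = 0 \<longleftrightarrow> y = 0"
  by (simp add: sector_def vec_eq_iff forall_2 sgn_zero_iff)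

lemma sector_range: "sector y \<in> {-2, -1, 0, 1, 2}"
  by (simp add: sector_def sgn_if)

lemma convex_sgn_level: "convex {x::real. sgn x = s}"
  unfolding is_interval_convex_1[symmetric] is_interval_1
  by (auto simp: sgn_if split: if_splits)

text \<open>Equal sectors put both points on the same side of the vertical axis or both on it, where
  the second coordinate decides; each sign has an interval as its level set.\<close>

lemma convex_sector_level: "convex {y. sector y = i}"
proof (rule convexI)
  fix x y :: "real^2" and u v :: real
  assume xy: "x \<in> {y. sector y = i}" "y \<in> {y. sector y = i}" and uv: "0 \<le> u" "0 \<le> v" "u + v = 1"
  have s: "sgn (u * a + v * b) = sgn a" if "sgn a = sgn b" for a b :: real
    using convexD[OF convex_sgn_level[of "sgn a"], of a b u v] that uv by simp
  have eq: "sector x = sector y"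
    using xy by simp
  have "sector (u *\<^sub>R x + v *\<^sub>R y) = sector x"
  proof (cases "x $ 1 = 0")
    case True
    then have "y $ 1 = 0"
      using eq by (auto simp: sector_def sgn_if split: if_splits)
    then show ?thesis
      using True eq s[of "x $ 2" "y $ 2"] by (simp add: sector_def)
  next
    case False
    then have "y $ 1 \<noteq> 0"
      using eq by (auto simp: sector_def sgn_if split: if_splits)
    then have *: "sgn (u * x $ 1 + v * y $ 1) = sgn (x $ 1)"
      using False eq s[of "x $ 1" "y $ 1"] by (simp add: sector_def)
    then have "u * x $ 1 + v * y $ 1 \<noteq> 0"
      using False by (metis sgn_zero_iff)
    then show ?thesis
      using False * by (simp add: sector_def)
  qed
  then show "u *\<^sub>R x + v *\<^sub>R y \<in> {y. sector y = i}"
    using xy by simp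
qed

lemma convex_sector_diff:
  assumes "linear f"
  shows "convex {w. sector (f w - c) = i}"
proof -
  have "{w. sector (f w - c) = i} = f -` ((+) c ` {y. sector y = i})"
    by (force simp: image_iff)
  then show ?thesis
    using convex_linear_vimage[OF assms convex_translation[OF convex_sector_level]] by simp
qed

text \<open>The label \<open>i\<close> keeps \<open>x\<close> off the root, or at it when
  \<open>i = 0\<close>. The label \<open>j\<close> replaces the condition that \<open>z\<close>
  differs from \<open>x\<close>, which could disconnect the pairs when \<open>x\<close> lies in the
  hull of \<open>I\<close>.\<close>

definition region_pairs ::
    "(real^2) set \<Rightarrow> real^2 \<Rightarrow> (real^2) set \<Rightarrow> real \<Rightarrow> real \<Rightarrow> ((real^2) \<times> (real^2)) set" where
  "region_pairs S c I i j = {(x, z). far_set S x = I \<and> sector (x - c) = i \<and>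
     z \<in> convex hull I - I \<and> sector (z - x) = j}"

definition region :: "(real^2) set \<Rightarrow> real^2 \<Rightarrow> (real^2) set \<Rightarrow> real \<Rightarrow> real \<Rightarrow> (real^2) set" where
  "region S c I i j = (\<lambda>(x, z). far_inversion S x z) ` region_pairs S c I i j"

lemma convex_region_pairs:
  assumes "finite S" "\<forall>x\<in>S. x extreme_point_of (convex hull S)" "I \<subseteq> S" "I \<noteq> {}"
  shows "convex (region_pairs S c I i j)"
proof -
  have "region_pairs S c I i j =
      ({x. far_set S x = I} \<inter> {x. sector (id x - c) = i}) \<times> (convex hull I - I)
      \<inter> {w. sector ((snd w - fst w) - 0) = j}"
    by (auto simp: region_pairs_def)
  moreover have "convex {x. far_set S x = I}"
    using assms(1,3,4) by (rule convex_far_set_eq)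
  moreover have "convex (convex hull I - I)"
    by (rule convex_diff_extreme_points[OF convex_convex_hull hull_mono[OF assms(3)]])
      (use assms in auto)
  moreover have "linear (\<lambda>w::(real^2) \<times> (real^2). snd w - fst w)"
    by (intro linear_compose_sub linear_fst linear_snd)
  ultimately show ?thesis
    by (simp only:) (intro convex_Int convex_Times convex_sector_diff linear_id)
qed

text \<open>The inversion formula is continuous on the convex set of pairs, since
  \<open>j \<noteq> 0\<close> keeps \<open>z\<close> away from the singularity at
  \<open>x\<close>.\<close>

lemma connected_region:
  assumes "finite S" "\<forall>x\<in>S. x extreme_point_of (convex hull S)" "I \<subseteq> S" "I \<noteq> {}" "j \<noteq> 0"
  shows "connected (region S c I i j)"
  unfolding region_def
proof (rule connected_continuous_image)
  show "connected (region_pairs S c I i j)"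
    using assms by (intro convex_connected convex_region_pairs)
  have "S \<noteq> {}" using assms by auto
  have ne: "fst w \<noteq> snd w" if "w \<in> region_pairs S c I i j" for w
    using that assms(5) sector_eq_0_iff[of "snd w - fst w"] by (auto simp: region_pairs_def)
  have far: "continuous_on (region_pairs S c I i j) (\<lambda>w. far_dist S (fst w))"
    by (rule continuous_on_compose2[OF continuous_on_far_dist[OF assms(1) \<open>S \<noteq> {}\<close>, of UNIV]])
      (auto intro: continuous_intros)
  show "continuous_on (region_pairs S c I i j) (\<lambda>(x, z). far_inversion S x z)"
    unfolding far_inversion_def case_prod_unfold
    by (intro continuous_intros far ballI) (use ne in auto)
qed

text \<open>All labels can be read off from \<open>p\<close> and its optimum: \<open>p - x\<close>
  is a positive multiple of \<open>z - x\<close>, so the two have the same sector. This yields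
  disjointness of the regions.\<close>

lemma regionE:
  assumes S: "finite S" "card S \<ge> 2" "\<forall>x\<in>S. x extreme_point_of (convex hull S)"
    and p: "p \<in> region S c I i j" "j \<noteq> 0"
  obtains x where "\<And>v. optimal S p v \<longleftrightarrow> v = Some x" "far_set S x = I" "sector (x - c) = i"
    "sector (p - x) = j" "1 < dist x p / far_dist S x" "x \<in> FVB S"
proof -
  obtain x z where xz: "(x, z) \<in> region_pairs S c I i j" and pz: "p = far_inversion S x z"
    using p(1) by (auto simp: region_def)
  then have "z \<noteq> x"
    using p(2) sector_eq_0_iff[of "z - x"] by (auto simp: region_pairs_def)
  have z: "z \<in> convex hull far_set S x - far_set S x"
    using xz by (auto simp: region_pairs_def)
  have "0 < (far_dist S x)\<^sup>2 / (dist x z)\<^sup>2"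
    using far_dist_pos[OF S(1,2), of x] \<open>z \<noteq> x\<close> by simp
  moreover have "p - x = ((far_dist S x)\<^sup>2 / (dist x z)\<^sup>2) *\<^sub>R (z - x)"
    by (simp add: pz far_inversion_def)
  ultimately have "sector (p - x) = j"
    using xz sector_scale by (simp add: region_pairs_def)
  with xz show thesis
    using optimal_far_inversion[OF S z \<open>z \<noteq> x\<close> pz] far_inversion_optimal(1)[OF S(1,2) z \<open>z \<noteq> x\<close> pz]
    by (intro that[of x]) (auto simp: region_pairs_def)
qed

lemma region_exists:
  assumes S: "finite S" "card S \<ge> 2" and p: "p \<notin> convex hull S"
  shows "\<exists>I i j. I \<subseteq> S \<and> i \<in> {-2, -1, 0, 1, 2} \<and> j \<in> {-2, -1, 1, 2} \<and> p \<in> region S c I i j"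
proof -
  obtain x z where z: "z \<in> convex hull far_set S x - far_set S x" "z \<noteq> x" "p = far_inversion S x z"
    using ratio_attains_max[OF S p] maximizer_is_inversion_centre[OF S] by blast
  have "sector (z - x) \<in> {-2, -1, 1, 2}"
    using sector_range[of "z - x"] sector_eq_0_iff[of "z - x"] z(2) by auto
  moreover have "p \<in> region S c (far_set S x) (sector (x - c)) (sector (z - x))"
    unfolding region_def region_pairs_def using z by (auto intro!: image_eqI[of _ _ "(x, z)"])
  moreover have "far_set S x \<subseteq> S"
    by (auto simp: far_set_def)
  ultimately show ?thesis
    using sector_range by blast
qed

text \<open>The farthest points of \<open>x\<close> lie on a common circle about
  \<open>x\<close>.\<close>

lemma far_set_card_le_3:
  assumes "finite S" "general_position S"
  shows "card (far_set S x) \<le> 3"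
proof (rule ccontr)
  assume "\<not> card (far_set S x) \<le> 3"
  then have "4 \<le> card (far_set S x)" by simp
  then obtain T where T: "T \<subseteq> far_set S x" "card T = 4"
    by (rule obtain_subset_with_card_n)
  then have "T \<subseteq> S" "T \<subseteq> sphere x (far_dist S x)"
    by (auto simp: far_set_def)
  then show False
    using assms(2) T(2) unfolding general_position_def by blast
qed

text \<open>Label 0 means the root. Otherwise three farthest points fix \<open>x\<close> as their
  circumcentre, a Voronoi node, and two leave a connected part of one edge that avoids the
  root.\<close>

lemma piece_in_node_or_open_edge:
  assumes S: "finite S" "card S \<ge> 2" "\<forall>x\<in>S. x extreme_point_of (convex hull S)"
    and gp: "general_position S"
    and I: "I \<subseteq> S" "2 \<le> card I" and X: "X = {x. far_set S x = I \<and> sector (x - mec_center S) = i}"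
    and "X \<noteq> {}"
  shows "(\<exists>v\<in>dv_nodes S. \<forall>x\<in>X. Some x = v) \<or> (\<exists>E\<in>dv_edges S. \<forall>x\<in>X. Some x \<in> open_edge E)"
proof -
  obtain v where v: "v \<in> X" using \<open>X \<noteq> {}\<close> by auto
  then have "card I \<le> 3"
    using far_set_card_le_3[OF S(1) gp] X by auto
  then consider "i = 0" | "i \<noteq> 0" "card I = 2" | "card I = 3"
    using I(2) by linarith
  then show ?thesis
  proof cases
    case 1
    then have "\<forall>x\<in>X. Some x = Some (mec_center S)"
      using X by (auto simp: sector_eq_0_iff)
    then show ?thesis by (auto simp: dv_nodes_def)
  next
    case 2
    then obtain a b where ab: "I = {a, b}" "a \<noteq> b"
      by (auto simp: card_2_iff)
    have "{x. sector (id x - mec_center S) = i} = {x. sector (x - mec_center S) = i}"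
      by simp
    then have "convex {x. sector (x - mec_center S) = i}"
      using convex_sector_diff[OF linear_id] by metis
    moreover have "convex {x. far_set S x = I}"
      using convex_far_set_eq[OF S(1) I(1)] ab by auto
    ultimately have "convex ({x. far_set S x = I} \<inter> {x. sector (x - mec_center S) = i})"
      by (intro convex_Int)
    then have "connected X"
      by (intro convex_connected) (simp add: X Collect_conj_eq)
    moreover have "far_set S x = {a, b} \<and> x \<noteq> mec_center S" if "x \<in> X" for x
      using that 2(1) X ab sector_eq_0_iff[of "x - mec_center S"] by auto
    ultimately show ?thesis
      using two_farthest_in_open_edge[OF S ab(2), of X] I(1) ab(1) \<open>X \<noteq> {}\<close> by blast
  next
    case 3
    then obtain a b d where abd: "I = {a, b, d}" "a \<noteq> b" "a \<noteq> d" "b \<noteq> d"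
      by (auto simp: card_3_iff)
    have far: "far_set S x = {a, b, d}" if "x \<in> X" for x
      using that X abd by auto
    have eq: "dist x a = dist x b" "dist x a = dist x d" if "x \<in> X" for x
    proof -
      have "a \<in> far_set S x" "b \<in> far_set S x" "d \<in> far_set S x"
        using far[OF that] by simp_all
      then show "dist x a = dist x b" "dist x a = dist x d"
        by (simp_all add: far_set_def)
    qed
    have "Some v \<in> fv_nodes S"
      using three_farthest_is_node[OF S far[OF v] abd(2-4)] .
    moreover have "x = v" if "x \<in> X" for x
      using equidistant_unique[OF eq[OF that] abd(2-4) eq[OF v]] .
    ultimately show ?thesis
      by (auto simp: dv_nodes_def)
  qed
qed

section \<open>Assembly of the partition\<close>

theorem theorem5p1:
  fixes S :: "(real^2) set"
  assumes "finite S"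
    and "card S \<ge> 2"
    and "general_position S"
    and "\<forall>x\<in>S. x extreme_point_of (convex hull S)"
  shows "(\<forall>p. \<not> p extreme_point_of (convex hull S) \<longrightarrow> (\<exists>!x. optimal S p x)) \<and>
    (\<exists>\<R>. finite \<R> \<and> partition_on {p. \<not> p extreme_point_of (convex hull S)} \<R> \<and>
      (\<forall>R\<in>\<R>. connected R \<and>
        ((\<exists>v\<in>dv_nodes S. \<forall>p\<in>R. optimal S p v) \<or>
         (\<exists>E\<in>dv_edges S. \<forall>p\<in>R. \<exists>x\<in>open_edge E. optimal S p x))))"
proof -
  note S = assms(1,2,4)
  have ext: "p extreme_point_of (convex hull S) \<longleftrightarrow> p \<in> S" for p
    using assms(4) extreme_point_of_convex_hull by blast
  define c where "c = mec_center S"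
  define L where "L = Pow S \<times> {-2, -1, 0, 1, 2::real} \<times> {-2, -1, 1, 2::real}"
  define reg where "reg = (\<lambda>(I, i, j). region S c I i j)"
  \<comment> \<open>The hull without its vertices is the region of the node at infinity; empty
    images are dropped because a partition has no empty block.\<close>
  define \<R> where "\<R> = insert (convex hull S - S) (reg ` L) - {{}}"
  have regE: "\<exists>x. (\<forall>v. optimal S p v \<longleftrightarrow> v = Some x) \<and> far_set S x = I \<and> sector (x - c) = i \<and>
      sector (p - x) = j \<and> 1 < dist x p / far_dist S x \<and> x \<in> FVB S"
    if "p \<in> reg (I, i, j)" "(I, i, j) \<in> L" for p I i j
  proof -
    have "j \<noteq> 0" using that(2) by (auto simp: L_def)
    moreover have "p \<in> region S c I i j" using that(1) by (simp add: reg_def)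
    ultimately show ?thesis
      by (metis regionE[OF S])
  qed
  have cover: "\<exists>l\<in>L. p \<in> reg l" if p: "p \<notin> convex hull S" for p
  proof -
    obtain I i j where "I \<subseteq> S" "i \<in> {-2, -1, 0, 1, 2}" "j \<in> {-2, -1, 1, 2}" "p \<in> region S c I i j"
      using region_exists[OF S(1,2) p, of c] by blast
    then have "(I, i, j) \<in> L"
      unfolding L_def by (intro SigmaI PowI)
    moreover have "p \<in> reg (I, i, j)"
      using \<open>p \<in> region S c I i j\<close> by (simp add: reg_def)
    ultimately show ?thesis by blast
  qed
  have uniq: "\<exists>!x. optimal S p x" if "p \<notin> S" for p
  proof (cases "p \<in> convex hull S")
    case True
    then show ?thesis
      using optimal_in_hull[OF S, of p] that by simp
  next
    case False
    then obtain I i j where "(I, i, j) \<in> L" "p \<in> reg (I, i, j)"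
      using cover by fastforce
    then obtain x where "\<forall>v. optimal S p v \<longleftrightarrow> v = Some x"
      using regE by blast
    then show ?thesis by simp
  qed
  \<comment> \<open>A point of \<open>S\<close> never has ratio above 1, whereas points of these
    regions do.\<close>
  have not_S: "p \<notin> S" if l: "p \<in> reg l" "l \<in> L" for p l
  proof
    assume "p \<in> S"
    obtain I i j where "l = (I, i, j)" by (cases l)
    then obtain x where "1 < dist x p / far_dist S x"
      using regE l by blast
    then show False
      using far_dist_ge[OF S(1) \<open>p \<in> S\<close>, of x] far_dist_pos[OF S(1,2), of x]
      by (simp add: divide_simps split: if_splits)
  qed
  have disj: "l = l'" if ll: "p \<in> reg l" "p \<in> reg l'" "l \<in> L" "l' \<in> L" for p l l'
  proof -
    obtain I i j I' i' j' where l: "l = (I, i, j)" "l' = (I', i', j')"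
      by (cases l, cases l')
    obtain x where x: "\<forall>v. optimal S p v \<longleftrightarrow> v = Some x" "far_set S x = I" "sector (x - c) = i"
        "sector (p - x) = j"
      using regE[of p I i j] ll l by blast
    obtain x' where x': "\<forall>v. optimal S p v \<longleftrightarrow> v = Some x'" "far_set S x' = I'" "sector (x' - c) = i'"
        "sector (p - x') = j'"
      using regE[of p I' i' j'] ll l by blast
    have "Some x = Some x'" using x(1) x'(1) by blast
    then have "x = x'" by simp
    then show ?thesis using x x' l by simp
  qed
  \<comment> \<open>The optimum would be infinity and a finite point at once.\<close>
  have disj_hull: "p \<notin> convex hull S - S" if l: "p \<in> reg l" "l \<in> L" for p l
  proof
    assume p: "p \<in> convex hull S - S"
    obtain I i j where "l = (I, i, j)" by (cases l)
    then obtain x where "\<forall>v. optimal S p v \<longleftrightarrow> v = Some x"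
      using regE l by blast
    then show False
      using optimal_in_hull[OF S p, of None] by simp
  qed
  have "finite \<R>"
    using S(1) by (simp add: \<R>_def L_def)
  moreover have "partition_on {p. \<not> p extreme_point_of (convex hull S)} \<R>"
  proof (rule partition_onI)
    show "\<Union>\<R> = {p. \<not> p extreme_point_of (convex hull S)}"
    proof (intro equalityI subsetI)
      fix p assume "p \<in> \<Union>\<R>"
      then show "p \<in> {p. \<not> p extreme_point_of (convex hull S)}"
        using not_S by (auto simp: \<R>_def ext)
    next
      fix p assume "p \<in> {p. \<not> p extreme_point_of (convex hull S)}"
      then have "p \<notin> S" by (simp add: ext)
      show "p \<in> \<Union>\<R>"
      proof (cases "p \<in> convex hull S")
        case True
        then have "p \<in> convex hull S - S" using \<open>p \<notin> S\<close> by simp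
        moreover from this have "convex hull S - S \<in> \<R>"
          unfolding \<R>_def by blast
        ultimately show ?thesis by (rule UnionI[rotated])
      next
        case False
        then obtain l where "l \<in> L" "p \<in> reg l" using cover by blast
        moreover from this have "reg l \<in> \<R>"
          unfolding \<R>_def by blast
        ultimately show ?thesis by blast
      qed
    qed
    show "disjnt P Q" if "P \<in> \<R>" "Q \<in> \<R>" "P \<noteq> Q" for P Q
      unfolding disjnt_iff
    proof (intro allI notI, elim conjE)
      fix p assume p: "p \<in> P" "p \<in> Q"
      have PQ: "P = convex hull S - S \<or> (\<exists>l\<in>L. P = reg l)" "Q = convex hull S - S \<or> (\<exists>l\<in>L. Q = reg l)"
        using that(1,2) by (auto simp: \<R>_def)
      show False
        using PQ p that(3) disj[of p] disj_hull[of p] by metis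
    qed
    show "{} \<notin> \<R>" by (simp add: \<R>_def)
  qed
  moreover have "connected R \<and> ((\<exists>v\<in>dv_nodes S. \<forall>p\<in>R. optimal S p v) \<or>
      (\<exists>E\<in>dv_edges S. \<forall>p\<in>R. \<exists>x\<in>open_edge E. optimal S p x))" if R: "R \<in> \<R>" for R
  proof -
    consider "R = convex hull S - S" | l where "l \<in> L" "R = reg l" "R \<noteq> {}"
      using R unfolding \<R>_def by blast
    then show ?thesis
    proof cases
      case 1
      have "convex R"
        unfolding 1 by (rule convex_diff_extreme_points[OF convex_convex_hull order_refl]) (simp add: ext)
      moreover have "None \<in> dv_nodes S"
        by (simp add: dv_nodes_def fv_nodes_def)
      moreover have "\<forall>p\<in>R. optimal S p None"
        using 1 optimal_in_hull[OF S] by simp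
      ultimately show ?thesis
        using convex_connected by blast
    next
      case 2
      obtain I i j where l: "l = (I, i, j)" by (cases l)
      have I: "I \<subseteq> S" "j \<noteq> 0" using 2(1) l by (auto simp: L_def)
      define X where "X = {x. far_set S x = I \<and> sector (x - mec_center S) = i}"
      have opt: "\<exists>x\<in>X. optimal S p (Some x) \<and> x \<in> FVB S" if pR: "p \<in> R" for p
      proof -
        obtain x where "\<forall>v. optimal S p v \<longleftrightarrow> v = Some x" "far_set S x = I" "sector (x - c) = i" "x \<in> FVB S"
          using regE[of p I i j] pR 2 l by blast
        then show ?thesis by (auto simp: X_def c_def)
      qed
      \<comment> \<open>Nonemptiness of \<open>R\<close> yields an optimum on the Voronoi boundary,
        so \<open>I\<close> has at least two elements; smaller labels only produce empty
        regions.\<close>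
      then obtain x where x: "x \<in> X" "x \<in> FVB S"
        using 2(3) by blast
      then obtain a b where ab: "a \<in> I" "b \<in> I" "a \<noteq> b"
        by (auto simp: X_def FVB_iff)
      have "finite I" using I(1) S(1) finite_subset by blast
      then have "2 \<le> card I"
        using ab card_le_Suc0_iff_eq[of I] by (auto simp: not_less_eq_eq numeral_2_eq_2)
      then consider v where "v \<in> dv_nodes S" "\<forall>x\<in>X. Some x = v"
        | E where "E \<in> dv_edges S" "\<forall>x\<in>X. Some x \<in> open_edge E"
        using piece_in_node_or_open_edge[OF S assms(3) I(1) _ X_def] x(1) by blast
      then have "(\<exists>v\<in>dv_nodes S. \<forall>p\<in>R. optimal S p v) \<or>
          (\<exists>E\<in>dv_edges S. \<forall>p\<in>R. \<exists>x\<in>open_edge E. optimal S p x)"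
      proof cases
        case (1 v)
        then have "\<forall>p\<in>R. optimal S p v" using opt by metis
        then show ?thesis using 1(1) by blast
      next
        case (2 E)
        then have "\<forall>p\<in>R. \<exists>x\<in>open_edge E. optimal S p x" using opt by metis
        then show ?thesis using 2(1) by blast
      qed
      moreover have "connected R"
        using connected_region[OF S(1,3) I(1) _ I(2), of c i] ab 2(2) l by (auto simp: reg_def)
      ultimately show ?thesis by blast
    qed
  qed
  ultimately show ?thesis
    using uniq by (simp add: ext) blast
qed

end
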